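(* Let $p_1,\dots,p_6$ be six distinct points on a non-degenerate conic $\mathcal{A}$ in the projective plane over $\mathbb{K}\in\{\mathbb{R},\mathbb{C}\}$. Construct (writing $XY$ for the line joining $X,Y$ and $\cap$ for the intersection of two lines): $B_3=p_1p_2\cap p_3p_4$, $G_3=p_1p_4\cap p_3p_6$, $G_4=G_3B_3\cap p_2p_5$, $B_6=G_3B_3\cap p_4p_5$, and $p_7=G_4p_4\cap B_6p_6$. Assuming all these steps are non-degenerate, the point $p_7$ is the seventh point of a Poncelet chain starting with $p_1,\dots,p_6$; that is, $p_7$ lies on $\mathcal{A}$ and $p_1,\dots,p_7$ are seven consecutive points of a Poncelet chain with circumscribed conic $\mathcal{A}$.
   Context: Poncelet chains: given conics $\mathcal{A}$ (outer) and $\mathcal{B}$ (inner), a Poncelet chain is a sequence $p_1,p_2,\dots$ of points on $\mathcal{A}$ obtained as follows: $l_1$ is a tangent to $\mathcal{B}$ through $p_1$; $p_{i+1}$ is the intersection of $l_i$ with $\mathcal{A}$ other than $p_i$; $l_{i+1}$ is the tangent to $\mathcal{B}$ through $p_{i+1}$ other than $l_i$. In particular the lines $p_ip_{i+1}$ are all tangent to the common conic $\mathcal{B}$. A construction step is non-degenerate if the two elements being joined or intersected are distinct, so that the result is well defined. *)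

theory Defs
  imports "HOL-Analysis.Analysis"
begin

(* The projective plane over a field: nonzero coordinate vectors up to scaling.
   Lines are given by their homogeneous line coordinates, hence by the same type.
   To work over the reals or the complex numbers, use scalars of class real_normed_field:
   by the Gelfand-Mazur theorem these two are its only instances up to isomorphism. *)

quotient_type (overloaded) 'a proj = "('a::field)^3" / partial:
  "\<lambda>x y. x \<noteq> 0 \<and> y \<noteq> 0 \<and> (\<exists>c. c \<noteq> 0 \<and> x = c *s y)"
proof (rule part_equivpI)
  show "\<exists>x::'a^3. x \<noteq> 0 \<and> x \<noteq> 0 \<and> (\<exists>c. c \<noteq> 0 \<and> x = c *s x)"
    by (rule exI[of _ "axis 1 1"]) (auto simp: axis_eq_0_iff intro: exI[of _ 1])
  show "symp (\<lambda>x y::'a^3. x \<noteq> 0 \<and> y \<noteq> 0 \<and> (\<exists>c. c \<noteq> 0 \<and> x = c *s y))"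
  proof (rule sympI, elim conjE exE, intro conjI)
    fix x y :: "'a^3" and c :: 'a
    assume "c \<noteq> 0" "x = c *s y"
    then show "\<exists>d. d \<noteq> 0 \<and> y = d *s x"
      by (intro exI[of _ "inverse c"]) (simp add: vector_smult_assoc)
  qed auto
  show "transp (\<lambda>x y::'a^3. x \<noteq> 0 \<and> y \<noteq> 0 \<and> (\<exists>c. c \<noteq> 0 \<and> x = c *s y))"
  proof (rule transpI, elim conjE exE, intro conjI)
    fix x y z :: "'a^3" and c d :: 'a
    assume "c \<noteq> 0" "x = c *s y" "d \<noteq> 0" "y = d *s z"
    then show "\<exists>e. e \<noteq> 0 \<and> x = e *s z"
      by (intro exI[of _ "c * d"]) (simp add: vector_smult_assoc)
  qed auto
qed

type_synonym 'a point = "'a proj"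
type_synonym 'a line = "'a proj"

lemma scalar_product_smult:
  fixes x y :: "('a::field)^3"
  shows "scalar_product (c *s x) y = c * scalar_product x y"
    and "scalar_product x (c *s y) = c * scalar_product x y"
  by (simp_all add: scalar_product_def sum_distrib_left mult_ac)

lift_definition incident :: "('a::field) point \<Rightarrow> 'a line \<Rightarrow> bool"
  is "\<lambda>x l. scalar_product x l = 0"
  by (auto simp: scalar_product_smult)

lift_definition on_conic :: "('a::field)^3^3 \<Rightarrow> 'a point \<Rightarrow> bool"
  is "\<lambda>M x. scalar_product x (M *v x) = 0"
  by (auto simp: scalar_product_smult vec.scale)

(* The inner conic is given by its dual matrix B, as the family of its tangents. If B is
   invertible, these are the tangents of the point conic with matrix B^-1, see lemma
   tangent_iff_touches below. Singular B must be allowed: if p1 p2, p3 p4 and p5 p6 meet in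
   one point, no nondegenerate conic touches all p_i p_(i+1), and the inner conic is a pair
   of points, its tangents being the lines through one of the two. *)
lift_definition tangent :: "('a::field)^3^3 \<Rightarrow> 'a line \<Rightarrow> bool"
  is "\<lambda>B l. scalar_product l (B *v l) = 0"
  by (auto simp: scalar_product_smult vec.scale)

definition join :: "('a::field) point \<Rightarrow> 'a point \<Rightarrow> 'a line" where
  "join P Q = (THE l. incident P l \<and> incident Q l)"

definition meet :: "('a::field) line \<Rightarrow> 'a line \<Rightarrow> 'a point" where
  "meet l m = (THE P. incident P l \<and> incident P m)"

definition concurrent :: "('a::field) line \<Rightarrow> 'a line \<Rightarrow> 'a line \<Rightarrow> bool" where
  "concurrent l m n \<longleftrightarrow> (\<exists>P. incident P l \<and> incident P m \<and> incident P n)"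

definition conic :: "('a::field)^3^3 \<Rightarrow> bool" where
  "conic M \<longleftrightarrow> transpose M = M \<and> M \<noteq> 0"

definition nondegenerate :: "('a::field)^3^3 \<Rightarrow> bool" where
  "nondegenerate M \<longleftrightarrow> det M \<noteq> 0"

(* Q is the intersection of l with A other than P, counted with multiplicity: Q = P is
   allowed only if l meets A in P alone, that is, if l touches A at P. *)
definition other_intersection ::
  "('a::field)^3^3 \<Rightarrow> 'a line \<Rightarrow> 'a point \<Rightarrow> 'a point \<Rightarrow> bool" where
  "other_intersection A l P Q \<longleftrightarrow> on_conic A Q \<and> incident Q l \<and>
     (Q = P \<longrightarrow> (\<forall>R. on_conic A R \<and> incident R l \<longrightarrow> R = P))"

(* Dually: m = l is allowed only if l is the only tangent through P. *)
definition other_tangent ::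
  "('a::field)^3^3 \<Rightarrow> 'a point \<Rightarrow> 'a line \<Rightarrow> 'a line \<Rightarrow> bool" where
  "other_tangent B P l m \<longleftrightarrow> tangent B m \<and> incident P m \<and>
     (m = l \<longrightarrow> (\<forall>n. tangent B n \<and> incident P n \<longrightarrow> n = l))"

(* p 0, p 1, ... is the chain of points, l 0, l 1, ... the chain of tangents. *)
definition poncelet_chain :: "('a::field)^3^3 \<Rightarrow> 'a^3^3 \<Rightarrow> (nat \<Rightarrow> 'a point) \<Rightarrow> bool" where
  "poncelet_chain A B p \<longleftrightarrow> (\<exists>l.
     on_conic A (p 0) \<and> incident (p 0) (l 0) \<and> tangent B (l 0) \<and>
     (\<forall>i. other_intersection A (l i) (p i) (p (Suc i)) \<and>
          other_tangent B (p (Suc i)) (l i) (l (Suc i))))"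

lemma proj_rep: obtains v :: "('a::field)^3" where "v \<noteq> 0" "P = abs_proj v"
  using Quotient_abs_rep[OF Quotient_proj] Quotient_rep_reflp[OF Quotient_proj] by metis

lemma abs_proj_eq_iff:
  fixes v w :: "('a::field)^3"
  assumes "v \<noteq> 0" "w \<noteq> 0"
  shows "abs_proj v = abs_proj w \<longleftrightarrow> (\<exists>c. c \<noteq> 0 \<and> v = c *s w)"
proof -
  have "u \<noteq> 0 \<Longrightarrow> \<exists>c. c \<noteq> 0 \<and> u = c *s u" for u :: "'a^3"
    by (rule exI[of _ 1]) simp
  with assms show ?thesis
    using Quotient_rel[OF Quotient_proj, of v w] by auto
qed

lemma incident_abs:
  fixes v w :: "('a::field)^3"
  assumes "v \<noteq> 0" "w \<noteq> 0"
  shows "incident (abs_proj v) (abs_proj w) \<longleftrightarrow> scalar_product v w = 0"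
proof -
  have "u \<noteq> 0 \<Longrightarrow> \<exists>c. c \<noteq> 0 \<and> u = c *s u" for u :: "'a^3"
    by (rule exI[of _ 1]) simp
  with assms show ?thesis by (intro incident.abs_eq) (auto simp: eq_onp_def)
qed

lemma on_conic_abs:
  fixes v :: "('a::field)^3"
  assumes "v \<noteq> 0"
  shows "on_conic M (abs_proj v) \<longleftrightarrow> scalar_product v (M *v v) = 0"
proof -
  have "u \<noteq> 0 \<Longrightarrow> \<exists>c. c \<noteq> 0 \<and> u = c *s u" for u :: "'a^3"
    by (rule exI[of _ 1]) simp
  with assms show ?thesis by (intro on_conic.abs_eq) auto
qed

lemma tangent_abs:
  fixes v :: "('a::field)^3"
  assumes "v \<noteq> 0"
  shows "tangent M (abs_proj v) \<longleftrightarrow> scalar_product v (M *v v) = 0"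
proof -
  have "u \<noteq> 0 \<Longrightarrow> \<exists>c. c \<noteq> 0 \<and> u = c *s u" for u :: "'a^3"
    by (rule exI[of _ 1]) simp
  with assms show ?thesis by (intro tangent.abs_eq) auto
qed

lemma incident_commute: "incident P l \<longleftrightarrow> incident l P"
  by transfer (simp add: scalar_product_def mult.commute)

lemma abs_proj_eqI:
  fixes a b :: "('a::field)^3"
  assumes "a \<noteq> 0" "b \<noteq> 0"
    and "a$1 * b$2 = a$2 * b$1" "a$1 * b$3 = a$3 * b$1" "a$2 * b$3 = a$3 * b$2"
  shows "abs_proj a = abs_proj b"
proof -
  from assms(2) obtain i where i: "b $ i \<noteq> 0" by (metis vec_eq_iff zero_index)
  have "a $ j = (a $ i / b $ i) * b $ j" for j
    using i assms(3-5) exhaust_3[of i] exhaust_3[of j] by (auto simp: field_simps)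
  then have eq: "a = (a $ i / b $ i) *s b"
    unfolding vec_eq_iff vector_smult_component by blast
  moreover have "a $ i / b $ i \<noteq> 0" using eq assms(1) by force
  ultimately show ?thesis using abs_proj_eq_iff[OF assms(1,2)] by blast
qed

lemma ex1_line:
  assumes "P \<noteq> (Q :: ('a::field) point)"
  shows "\<exists>!l. incident P l \<and> incident Q l"
proof -
  obtain v w :: "'a^3" where vw: "v \<noteq> 0" "P = abs_proj v" "w \<noteq> 0" "Q = abs_proj w"
    by (metis proj_rep)
  define x :: "'a^3" where
    "x = vector [v$2 * w$3 - v$3 * w$2, v$3 * w$1 - v$1 * w$3, v$1 * w$2 - v$2 * w$1]"
  have x: "x \<noteq> 0"
  proof
    assume "x = 0"
    then have "v$2 * w$3 = v$3 * w$2" "v$3 * w$1 = v$1 * w$3" "v$1 * w$2 = v$2 * w$1"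
      by (simp_all add: x_def vec_eq_iff forall_3)
    then show False using abs_proj_eqI[OF vw(1,3)] vw assms by auto
  qed
  have "scalar_product v x = 0" "scalar_product w x = 0"
    by (simp_all add: scalar_product_def sum_3 x_def algebra_simps)
  then have "incident P (abs_proj x) \<and> incident Q (abs_proj x)"
    by (simp add: vw x incident_abs)
  moreover have "l = abs_proj x" if "incident P l \<and> incident Q l" for l
  proof -
    obtain a where a: "a \<noteq> 0" "l = abs_proj a" by (metis proj_rep)
    with that vw have "v$1 * a$1 + v$2 * a$2 + v$3 * a$3 = 0"
      "w$1 * a$1 + w$2 * a$2 + w$3 * a$3 = 0"
      by (simp_all add: incident_abs scalar_product_def sum_3)
    then have "a$1 * x$2 = a$2 * x$1" "a$1 * x$3 = a$3 * x$1" "a$2 * x$3 = a$3 * x$2"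
      unfolding x_def vector_3 by algebra+
    with abs_proj_eqI[OF a(1) x] a(2) show ?thesis by simp
  qed
  ultimately show ?thesis by blast
qed

lemma incident_join:
  assumes "P \<noteq> Q"
  shows "incident P (join P Q)" "incident Q (join P Q)"
  unfolding join_def using theI'[OF ex1_line[OF assms]] by auto

lemma incident_meet:
  assumes "l \<noteq> m"
  shows "incident (meet l m) l" "incident (meet l m) m"
  unfolding meet_def using theI'[OF ex1_line[OF assms]] by (auto simp: incident_commute)

(* Tangents in dual coordinates are the lines meeting the point conic in exactly one point. *)

lemma scalar_product_add:
  fixes x y z :: "('a::field)^3"
  shows "scalar_product (x + y) z = scalar_product x z + scalar_product y z"
    and "scalar_product z (x + y) = scalar_product z x + scalar_product z y"
  by (simp_all add: scalar_product_def sum_3 algebra_simps)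

lemma scalar_product_commute: "scalar_product x y = scalar_product y (x :: ('a::field)^3)"
  by (simp add: scalar_product_def mult.commute)

lemma scalar_product_symmetric:
  fixes M :: "('a::field)^3^3"
  assumes "transpose M = M"
  shows "scalar_product x (M *v y) = scalar_product (M *v x) y"
proof -
  have "M$i$j = M$j$i" for i j
    by (subst assms[symmetric]) (simp add: transpose_def)
  from this[of 2 1] this[of 3 1] this[of 3 2] show ?thesis
    by (simp add: scalar_product_def matrix_vector_mult_def sum_3 algebra_simps)
qed

lemma ex_other_point:
  assumes "incident P (l :: ('a::field) line)"
  shows "\<exists>Q. incident Q l \<and> Q \<noteq> P"
proof -
  obtain p where p: "p \<noteq> 0" "P = abs_proj p" by (metis proj_rep)
  then obtain i where i: "p $ i \<noteq> 0" by (metis vec_eq_iff zero_index)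
  define m where "m = abs_proj (axis i 1 :: 'a^3)"
  have "scalar_product p (axis i 1) = p $ i"
    by (simp add: scalar_product_def axis_def if_distrib cong: if_cong)
  with i p have "\<not> incident P m"
    by (simp add: m_def incident_abs axis_eq_0_iff)
  with assms incident_meet[of l m] show ?thesis by metis
qed

lemma tangent_iff_touches:
  fixes M :: "('a::field_char_0)^3^3"
  assumes M: "conic M" "nondegenerate M"
  shows "tangent (matrix_inv M) l \<longleftrightarrow> (\<exists>!P. on_conic M P \<and> incident P l)"
proof -
  have sym: "transpose M = M" using M by (simp add: conic_def)
  note sps = scalar_product_symmetric[OF sym]
  have "invertible M" using M by (simp add: nondegenerate_def invertible_det_nz)
  then have "M ** matrix_inv M = mat 1 \<and> matrix_inv M ** M = mat 1"
    unfolding invertible_def matrix_inv_def by (rule someI_ex)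
  then have inv: "M ** matrix_inv M = mat 1" "matrix_inv M ** M = mat 1" by blast+
  obtain a where a: "a \<noteq> 0" "l = abs_proj a" by (metis proj_rep)
  define v where "v = matrix_inv M *v a"
  have av: "a = M *v v" by (simp add: v_def matrix_vector_mul_assoc inv)
  then have v: "v \<noteq> 0" using a by auto
  have nz: "M *v x \<noteq> 0" if "x \<noteq> 0" for x
    using that by (metis inv(2) matrix_vector_mul_assoc matrix_vector_mul_lid matrix_vector_mult_0_right)
  have inj: "abs_proj x = abs_proj y" if xy: "x \<noteq> 0" "y \<noteq> 0" "abs_proj (M *v x) = abs_proj (M *v y)" for x y
  proof -
    obtain c where c: "c \<noteq> 0" "M *v x = c *s (M *v y)"
      using xy(3) abs_proj_eq_iff[OF nz[OF xy(1)] nz[OF xy(2)]] by auto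
    then have "matrix_inv M *v (M *v x) = c *s (matrix_inv M *v (M *v y))"
      by (simp only: vec.scale)
    then have "x = c *s y"
      by (simp only: matrix_vector_mul_assoc inv matrix_vector_mul_lid)
    with c show ?thesis using abs_proj_eq_iff[OF xy(1,2)] by blast
  qed
  have tan: "tangent (matrix_inv M) l \<longleftrightarrow> scalar_product v (M *v v) = 0"
    by (simp only: a(2) tangent_abs[OF a(1)] flip: v_def) (simp only: av scalar_product_commute)
  show ?thesis
  proof
    assume "tangent (matrix_inv M) l"
    with tan have vv: "scalar_product v (M *v v) = 0" by simp
    show "\<exists>!P. on_conic M P \<and> incident P l"
    proof (rule ex1I)
      show "on_conic M (abs_proj v) \<and> incident (abs_proj v) l"
        using vv a v by (simp add: on_conic_abs incident_abs av)
      fix Q assume Q: "on_conic M Q \<and> incident Q l"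
      obtain w where w: "w \<noteq> 0" "Q = abs_proj w" by (metis proj_rep)
      have ww: "scalar_product w (M *v w) = 0" "scalar_product w (M *v v) = 0"
        using Q a w by (simp_all add: on_conic_abs incident_abs av)
      then have "scalar_product v (M *v w) = 0"
        by (metis sps scalar_product_commute)
      show "Q = abs_proj v"
      proof (rule ccontr)
        assume ne: "Q \<noteq> abs_proj v"
        have "abs_proj (M *v w) = abs_proj (M *v v)"
          using ex1_line[OF ne] ww vv \<open>scalar_product v (M *v w) = 0\<close> nz[OF w(1)] nz[OF v] w v
          by (metis incident_abs)
        with inj[OF w(1) v] w ne show False by simp
      qed
    qed
  next
    assume ex1: "\<exists>!P. on_conic M P \<and> incident P l"
    then obtain P where P: "on_conic M P" "incident P l" by blast
    obtain p where p: "p \<noteq> 0" "P = abs_proj p" by (metis proj_rep)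
    obtain Q where Q: "incident Q l" "Q \<noteq> P" using ex_other_point[OF P(2)] by blast
    obtain q where q: "q \<noteq> 0" "Q = abs_proj q" by (metis proj_rep)
    have pp: "scalar_product p (M *v p) = 0" "scalar_product p a = 0" "scalar_product q a = 0"
      using P Q a p q by (simp_all add: on_conic_abs incident_abs)
    define b where "b = scalar_product q (M *v p)"
    have b': "scalar_product p (M *v q) = b"
      by (metis b_def sps scalar_product_commute)
    have "b = 0"
    proof (rule ccontr)
      assume b: "b \<noteq> 0"
      define t where "t = - scalar_product q (M *v q) / (2 * b)"
      define r where "r = q + t *s p"
      have r: "r \<noteq> 0"
      proof
        assume "r = 0"
        then have e: "q = (- t) *s p"
          by (simp add: r_def vector_smult_lneg eq_neg_iff_add_eq_0)
        with q(1) have "- t \<noteq> 0" by auto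
        with e abs_proj_eq_iff[OF q(1) p(1)] Q(2) p q show False by blast
      qed
      have "scalar_product r (M *v r) = scalar_product q (M *v q) + 2 * t * b"
        by (simp add: r_def matrix_vector_right_distrib scalar_product_add vec.scale
            scalar_product_smult pp b' flip: b_def)
      also have "\<dots> = 0" using b by (simp add: t_def)
      finally have "on_conic M (abs_proj r)" using r by (simp add: on_conic_abs)
      moreover have "incident (abs_proj r) l"
        using r a pp by (simp add: incident_abs r_def scalar_product_add scalar_product_smult)
      ultimately have "abs_proj r = abs_proj p" using ex1 P p by blast
      then obtain c where "q + t *s p = c *s p"
        using abs_proj_eq_iff[OF r p(1)] by (auto simp: r_def)
      then have e: "q = (c - t) *s p"
        by (simp add: vec.scale_left_diff_distrib eq_diff_eq)
      with q(1) have "c - t \<noteq> 0" by auto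
      with e abs_proj_eq_iff[OF q(1) p(1)] Q(2) p q show False by blast
    qed
    then have "incident P (abs_proj (M *v p)) \<and> incident Q (abs_proj (M *v p))"
      using p q nz[OF p(1)] pp(1) by (simp add: incident_abs b_def)
    then have "abs_proj (M *v p) = abs_proj (M *v v)"
      using ex1_line[of P Q] P Q a av by metis
    then have "abs_proj p = abs_proj v" by (rule inj[OF p(1) v])
    then show "tangent (matrix_inv M) l"
      using P p v by (simp add: tan on_conic_abs)
  qed
qed

end

theory Submission
  imports Defs
begin

text \<open>Choose coordinates in which the conic is \<open>y\<^sup>2 = x z\<close>, with \<open>p4 = (1, 0, 0)\<close>,
  \<open>p6 = (0, 0, 1)\<close>, \<open>p1 = (1, 1, 1)\<close> and \<open>p2\<close>, \<open>p3\<close>, \<open>p5\<close> of the form \<open>(t\<^sup>2, t, 1)\<close> for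
  \<open>t = b, c, e\<close>. The construction then gives \<open>p7 = (m\<^sup>2, m, 1)\<close> with \<open>e m = b e - b + c\<close>.
  The line through the points with parameters \<open>s\<close> and \<open>t\<close> is \<open>(1, -(s + t), s t)\<close>, so a dual conic
  is a symmetric biquadratic form \<open>F s t\<close>. Touching the first five chords means that
  \<open>F \<infinity>\<close> has the roots \<open>c, e\<close>, that \<open>F b\<close> has the roots \<open>1, c\<close> and that \<open>F 0\<close> has the root \<open>e\<close>.
  This determines \<open>F\<close> up to scaling, and the other root of \<open>F 0\<close> turns out to be \<open>m\<close>.\<close>

lemma join_eqI:
  assumes "P \<noteq> Q" "incident P l" "incident Q l"
  shows "join P Q = l"
  using ex1_line[OF assms(1)] incident_join[OF assms(1)] assms by blast

lemma meet_eqI: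
  assumes "l \<noteq> m" "incident P l" "incident P m"
  shows "meet l m = P"
  using ex1_line[OF assms(1)] incident_meet[OF assms(1)] assms by (metis incident_commute)

section \<open>Extending a finite Poncelet chain\<close>

text \<open>If no common point of \<open>l\<close> and \<open>A\<close> other than \<open>P\<close>
  exists, the multiplicity clause admits \<open>Q = P\<close>.\<close>

lemma ex_other_intersection:
  assumes "on_conic A P" "incident P l"
  shows "\<exists>Q. other_intersection A l P Q"
  unfolding other_intersection_def using assms by metis

lemma ex_other_tangent:
  assumes "tangent B l" "incident P l"
  shows "\<exists>m. other_tangent B P l m"
  unfolding other_tangent_def using assms by metis

text \<open>A \<open>poncelet_chain\<close> is infinite, so the given \<open>n\<close> steps are
  prolonged by dependent choice; a further step always exists by the two preceding lemmas.\<close>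

lemma poncelet_chain_extend:
  fixes p :: "nat \<Rightarrow> ('a::field) point" and l :: "nat \<Rightarrow> 'a line"
  assumes "on_conic A (p 0)" "incident (p 0) (l 0)" "tangent B (l 0)"
    and step: "\<And>i. i < n \<Longrightarrow> other_intersection A (l i) (p i) (p (Suc i))"
      "\<And>i. i < n \<Longrightarrow> other_tangent B (p (Suc i)) (l i) (l (Suc i))"
  shows "\<exists>q. poncelet_chain A B q \<and> (\<forall>i\<le>n. q i = p i)"
proof -
  \<comment> \<open>States are pairs of a point and a line. The invariant keeps the state able to
    continue and pins it to the given data up to index \<open>n\<close>.\<close>
  define I where "I i x \<longleftrightarrow> on_conic A (fst x) \<and> incident (fst x) (snd x) \<and> tangent B (snd x)
    \<and> (i \<le> n \<longrightarrow> x = (p i, l i))" for i x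
  define S where "S x y \<longleftrightarrow> other_intersection A (snd x) (fst x) (fst y)
    \<and> other_tangent B (fst y) (snd x) (snd y)" for x y
  have "\<exists>f. \<forall>i. I i (f i) \<and> S (f i) (f (Suc i))"
  proof (rule dependent_nat_choice)
    show "\<exists>x. I 0 x"
      using assms by (intro exI[of _ "(p 0, l 0)"]) (simp add: I_def)
  next
    fix x i assume x: "I i x"
    show "\<exists>y. I (Suc i) y \<and> S x y"
    proof (cases "i < n")
      case True
      with x have "S x (p (Suc i), l (Suc i))"
        using step[of i] by (auto simp: I_def S_def)
      moreover from this have "I (Suc i) (p (Suc i), l (Suc i))"
        by (auto simp: I_def S_def other_intersection_def other_tangent_def)
      ultimately show ?thesis by blast
    next
      \<comment> \<open>Here \<open>Suc i > n\<close>, so the pinning clause is vacuous and the next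
        state is free.\<close>
      case False
      obtain Q where Q: "other_intersection A (snd x) (fst x) Q"
        using x ex_other_intersection unfolding I_def by blast
      moreover obtain m where "other_tangent B Q (snd x) m"
        using Q x ex_other_tangent unfolding I_def other_intersection_def by blast
      ultimately have "I (Suc i) (Q, m) \<and> S x (Q, m)"
        using False by (auto simp: I_def S_def other_intersection_def other_tangent_def)
      then show ?thesis by blast
    qed
  qed
  then obtain f where f: "\<And>i. I i (f i)" "\<And>i. S (f i) (f (Suc i))" by blast
  have "poncelet_chain A B (fst \<circ> f)"
    unfolding poncelet_chain_def
    using f[unfolded I_def S_def] assms(1-3) by (intro exI[of _ "snd \<circ> f"]) auto
  moreover have "\<forall>i\<le>n. (fst \<circ> f) i = p i"
    using f(1) by (simp add: I_def)
  ultimately show ?thesis by blast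
qed

section \<open>Coordinate frames\<close>

lemma vector_3_surj: "\<exists>x y z. v = (vector [x, y, z] :: 'a::zero^3)"
  by (intro exI[of _ "v$1"] exI[of _ "v$2"] exI[of _ "v$3"]) (simp add: vec_eq_iff forall_3)

lemma vector_3_eq_0_iff: "(vector [x, y, z] :: 'a::zero^3) = 0 \<longleftrightarrow> x = 0 \<and> y = 0 \<and> z = 0"
  by (simp add: vec_eq_iff forall_3)

lemma scalar_product_vector_3:
  "scalar_product (vector [x, y, z] :: 'a^3) (vector [a, b, c]) = x * a + y * b + z * (c :: 'a::field)"
  by (simp add: scalar_product_def sum_3)

lemma scalar_product_transpose:
  fixes x y :: "('a::field)^3"
  shows "scalar_product (M *v x) y = scalar_product x (transpose M *v y)"
  by (simp add: scalar_product_def matrix_vector_mult_def transpose_def sum_3 algebra_simps)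

text \<open>Used in contrapositive form: a single non-tangent line shows that a dual matrix is
  nonzero.\<close>

lemma tangent_0: "tangent 0 l"
  by transfer (simp add: scalar_product_def)

locale frame =
  fixes M N :: "('a::field)^3^3"
  assumes MN: "M ** N = mat 1"
begin

definition pt :: "'a \<Rightarrow> 'a \<Rightarrow> 'a \<Rightarrow> 'a point" where
  "pt x y z = abs_proj (M *v vector [x, y, z])"

text \<open>Line coordinates transform contragrediently to point coordinates, which keeps incidence
  the standard pairing.\<close>

definition ln :: "'a \<Rightarrow> 'a \<Rightarrow> 'a \<Rightarrow> 'a line" where
  "ln x y z = abs_proj (transpose N *v vector [x, y, z])"

lemma NM: "N ** M = mat 1"
  using MN by (simp add: matrix_left_right_inverse)

lemma tNM: "transpose N ** transpose M = mat 1" "transpose M ** transpose N = mat 1"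
  using MN NM by (simp_all add: transpose_mat flip: matrix_transpose_mul)

lemma mult_vector_eq_0_iff: "M *v x = 0 \<longleftrightarrow> x = 0" "transpose N *v x = 0 \<longleftrightarrow> x = 0"
  using NM tNM by (metis matrix_vector_mul_assoc matrix_vector_mul_lid matrix_vector_mult_0_right)+

lemma pt_surj: obtains x y z where "P = pt x y z" "x \<noteq> 0 \<or> y \<noteq> 0 \<or> z \<noteq> 0"
proof -
  obtain v where v: "v \<noteq> 0" "P = abs_proj v" by (metis proj_rep)
  obtain x y z where "N *v v = vector [x, y, z]" using vector_3_surj by blast
  then have "v = M *v vector [x, y, z]"
    by (metis MN matrix_vector_mul_assoc matrix_vector_mul_lid)
  with v show ?thesis
    by (intro that[of x y z]) (auto simp: pt_def mult_vector_eq_0_iff vector_3_eq_0_iff)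
qed

lemma ln_surj: obtains x y z where "l = ln x y z" "x \<noteq> 0 \<or> y \<noteq> 0 \<or> z \<noteq> 0"
proof -
  obtain v where v: "v \<noteq> 0" "l = abs_proj v" by (metis proj_rep)
  obtain x y z where "transpose M *v v = vector [x, y, z]" using vector_3_surj by blast
  then have "v = transpose N *v vector [x, y, z]"
    by (metis tNM(1) matrix_vector_mul_assoc matrix_vector_mul_lid)
  with v show ?thesis
    by (intro that[of x y z]) (auto simp: ln_def mult_vector_eq_0_iff vector_3_eq_0_iff
        simp del: transpose_matrix_vector)
qed

lemma pt_scale: "c \<noteq> 0 \<Longrightarrow> x \<noteq> 0 \<or> y \<noteq> 0 \<or> z \<noteq> 0 \<Longrightarrow> pt (c * x) (c * y) (c * z) = pt x y z"
  unfolding pt_def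
proof (subst abs_proj_eq_iff)
  assume c: "c \<noteq> 0" "x \<noteq> 0 \<or> y \<noteq> 0 \<or> z \<noteq> 0"
  then show "M *v vector [c * x, c * y, c * z] \<noteq> 0" "M *v vector [x, y, z] \<noteq> 0"
    by (auto simp: mult_vector_eq_0_iff vector_3_eq_0_iff)
  have "vector [c * x, c * y, c * z] = c *s (vector [x, y, z] :: 'a^3)"
    by (simp add: vec_eq_iff forall_3)
  with c(1) show "\<exists>d. d \<noteq> 0 \<and> M *v vector [c * x, c * y, c * z] = d *s (M *v vector [x, y, z])"
    by (metis vec.scale)
qed

lemma incident_iff:
  assumes "x \<noteq> 0 \<or> y \<noteq> 0 \<or> z \<noteq> 0" "a \<noteq> 0 \<or> b \<noteq> 0 \<or> c \<noteq> 0"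
  shows "incident (pt x y z) (ln a b c) \<longleftrightarrow> x * a + y * b + z * c = 0"
proof -
  have "scalar_product (M *v v) (transpose N *v w) = scalar_product v w" for v w
    by (simp add: scalar_product_transpose matrix_vector_mul_assoc tNM del: transpose_matrix_vector)
  then show ?thesis
    using assms unfolding pt_def ln_def
    by (subst incident_abs) (auto simp: mult_vector_eq_0_iff vector_3_eq_0_iff scalar_product_vector_3
        simp del: transpose_matrix_vector)
qed

text \<open>\<open>D\<close> is a dual form in frame coordinates and
  \<open>M ** D ** transpose M\<close> is the same form in the original ones: the factors
  \<open>transpose N\<close> and \<open>N\<close> from the line vectors cancel.\<close>

lemma tangent_iff:
  assumes "a \<noteq> 0 \<or> b \<noteq> 0 \<or> c \<noteq> 0"
  shows "tangent (M ** D ** transpose M) (ln a b c)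
    \<longleftrightarrow> scalar_product (vector [a, b, c]) (D *v vector [a, b, c]) = 0"
proof -
  have "scalar_product (transpose N *v w) ((M ** D ** transpose M) *v (transpose N *v w))
    = scalar_product w (D *v w)" for w
  proof -
    have "M ** D ** transpose M ** transpose N = M ** D"
      by (simp add: tNM flip: matrix_mul_assoc)
    moreover have "N ** (M ** D) = D"
      by (simp add: matrix_mul_assoc NM)
    ultimately show ?thesis
      by (simp add: scalar_product_transpose matrix_vector_mul_assoc matrix_mul_assoc
          del: transpose_matrix_vector)
  qed
  then show ?thesis
    using assms unfolding ln_def
    by (subst tangent_abs) (auto simp: mult_vector_eq_0_iff vector_3_eq_0_iff
        simp del: transpose_matrix_vector)
qed

end

text \<open>Otherwise the polars \<open>A *v u\<close> and \<open>A *v w\<close> would both pass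
  through both points, hence coincide, and inverting \<open>A\<close> would make \<open>u\<close>
  and \<open>w\<close> proportional.\<close>

lemma not_conjugate:
  fixes A :: "('a::field)^3^3"
  assumes A: "transpose A = A" "det A \<noteq> 0"
    and uw: "u \<noteq> 0" "w \<noteq> 0" "abs_proj u \<noteq> abs_proj w"
    and on: "on_conic A (abs_proj u)" "on_conic A (abs_proj w)"
  shows "scalar_product u (A *v w) \<noteq> 0"
proof
  assume eq: "scalar_product u (A *v w) = 0"
  obtain A' where A': "A' ** A = mat 1" using A(2) invertible_det_nz unfolding invertible_def by blast
  have nz: "A *v x \<noteq> 0" if "x \<noteq> 0" for x
    using that A' by (metis matrix_vector_mul_assoc matrix_vector_mul_lid matrix_vector_mult_0_right)
  have "scalar_product w (A *v u) = 0"
    using eq by (metis scalar_product_symmetric[OF A(1)] scalar_product_commute)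
  then have "abs_proj (A *v u) = abs_proj (A *v w)"
    using ex1_line[OF uw(3)] eq on uw nz by (metis incident_abs on_conic_abs)
  then obtain c where c: "c \<noteq> 0" "A *v u = c *s (A *v w)"
    using abs_proj_eq_iff[OF nz[OF uw(1)] nz[OF uw(2)]] by blast
  then have "A' *v (A *v u) = c *s (A' *v (A *v w))" by (simp only: vec.scale)
  then have "u = c *s w" by (simp only: matrix_vector_mul_assoc A' matrix_vector_mul_lid)
  with c uw show False using abs_proj_eq_iff[OF uw(1,2)] by blast
qed

locale conic_frame = frame M N for M N :: "('a::field)^3^3" +
  fixes A :: "'a^3^3"
  assumes on_conic_iff:
    "x \<noteq> 0 \<or> y \<noteq> 0 \<or> z \<noteq> 0 \<Longrightarrow> on_conic A (pt x y z) \<longleftrightarrow> y * y = x * z"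
begin

lemma on_conic_param:
  assumes "on_conic A P" "P \<noteq> pt 1 0 0"
  obtains t where "P = pt (t * t) t 1"
proof -
  obtain x y z where P: "P = pt x y z" "x \<noteq> 0 \<or> y \<noteq> 0 \<or> z \<noteq> 0" by (rule pt_surj)
  have yy: "y * y = x * z" using assms P on_conic_iff by simp
  have "z \<noteq> 0"
  proof
    assume "z = 0"
    with yy P pt_scale[of x 1 0 0] assms(2) show False by simp
  qed
  then have "z * (y / z * (y / z)) = x" "z * (y / z) = y"
    using yy by (simp_all add: field_simps)
  then have "P = pt ((y / z) * (y / z)) (y / z) 1"
    using pt_scale[of z "y / z * (y / z)" "y / z" 1] \<open>z \<noteq> 0\<close> P(1) by simp
  then show ?thesis by (rule that)
qed

end

lemma ex_conic_frame:
  fixes A :: "('a::field_char_0)^3^3"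
  assumes A: "conic A" "nondegenerate A"
    and on: "on_conic A P" "on_conic A Q" "on_conic A R"
    and ne: "P \<noteq> Q" "P \<noteq> R" "Q \<noteq> R"
  obtains M N where "conic_frame M N A" "frame.pt M 1 0 0 = P" "frame.pt M 1 1 1 = Q"
    "frame.pt M 0 0 1 = R"
proof -
  have sym: "transpose A = A" and det: "det A \<noteq> 0"
    using A by (simp_all add: conic_def nondegenerate_def)
  define f where "f x y = scalar_product x (A *v y)" for x y
  have f_sym: "f x y = f y x" for x y
    unfolding f_def by (metis scalar_product_symmetric[OF sym] scalar_product_commute)
  have f_lin: "f (x + y) z = f x z + f y z" "f z (x + y) = f z x + f z y"
    "f (x - y) z = f x z - f y z" "f z (x - y) = f z x - f z y"
    "f (c *s x) z = c * f x z" "f z (c *s x) = c * f z x" for x y z c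
    by (simp_all add: f_def scalar_product_def matrix_vector_mult_def sum_3 algebra_simps)
  obtain p q r where rep: "p \<noteq> 0" "P = abs_proj p" "q \<noteq> 0" "Q = abs_proj q"
    "r \<noteq> 0" "R = abs_proj r" by (metis proj_rep)
  have f0: "f p p = 0" "f q q = 0" "f r r = 0"
    using on rep by (simp_all add: f_def on_conic_abs)
  have fnz: "f p q \<noteq> 0" "f p r \<noteq> 0" "f q r \<noteq> 0"
    unfolding f_def using not_conjugate[OF sym det] rep ne on by blast+
  \<comment> \<open>The scalars are forced by \<open>f v u = f v w = 0\<close> for
    \<open>v = q - u - w\<close>: then \<open>v\<close> represents the pole of the line
    \<open>PR\<close>, and \<open>q\<close> is the unit point. \<open>h\<close> is the common value
    of \<open>f u w\<close>, \<open>f u q\<close> and \<open>f w q\<close>.\<close>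
  define u where "u = (f q r / f p r) *s p"
  define w where "w = (f p q / f p r) *s r"
  define v where "v = q - u - w"
  define h where "h = f p q * f q r / f p r"
  define M :: "'a^3^3" where "M = (\<chi> i. vector [u $ i, v $ i, w $ i])"
  have M: "M *v vector [x, y, z] = x *s u + y *s v + z *s w" for x y z
    by (simp add: vec_eq_iff M_def matrix_vector_mult_def sum_3 algebra_simps)
  have fuw: "f u u = 0" "f w w = 0" "f u w = h" "f w u = h" "f u q = h" "f q u = h"
    "f w q = h" "f q w = h"
    using fnz by (simp_all add: u_def w_def h_def f_lin f0 f_sym[of r p] f_sym[of r q] f_sym[of q p])
  then have fv: "f v u = 0" "f u v = 0" "f v w = 0" "f w v = 0" "f v v = - (2 * h)"
    by (simp_all add: v_def f_lin f0)
  have form: "f (M *v vector [x, y, z]) (M *v vector [x, y, z]) = 2 * h * (x * z - y * y)" for x y z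
    by (simp add: M f_lin fuw fv algebra_simps)
  have h: "h \<noteq> 0" using fnz by (simp add: h_def)
  have "u \<noteq> 0" "w \<noteq> 0" using fnz rep by (simp_all add: u_def w_def vec.scale_eq_0_iff)
  \<comment> \<open>Pairing a kernel vector with \<open>w\<close>, \<open>v\<close> and
    \<open>u\<close> isolates one coordinate at a time.\<close>
  have M_inj: "x = 0" if "M *v x = 0" for x
  proof -
    obtain a b c where x: "x = vector [a, b, c]" using vector_3_surj by blast
    have "f (M *v x) y = 0" for y using that by (simp add: f_def scalar_product_def)
    then have 0: "f (a *s u + b *s v + c *s w) u = 0" "f (a *s u + b *s v + c *s w) v = 0"
      "f (a *s u + b *s v + c *s w) w = 0" by (simp_all only: x M)
    then have "c * h = 0" "b * h = 0" "a * h = 0"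
      by (simp_all add: f_lin fuw fv)
    with h x show ?thesis by (simp add: vector_3_eq_0_iff)
  qed
  then have "\<exists>N. N ** M = mat 1" by (simp add: matrix_left_invertible_ker)
  then obtain N where "N ** M = mat 1" by blast
  then have "M ** N = mat 1" by (simp add: matrix_left_right_inverse)
  then interpret frame M N by unfold_locales
  have "conic_frame M N A"
  proof unfold_locales
    fix x y z :: 'a assume "x \<noteq> 0 \<or> y \<noteq> 0 \<or> z \<noteq> 0"
    then have "on_conic A (pt x y z) \<longleftrightarrow> f (M *v vector [x, y, z]) (M *v vector [x, y, z]) = 0"
      unfolding pt_def f_def by (intro on_conic_abs) (simp add: mult_vector_eq_0_iff vector_3_eq_0_iff)
    with form h show "on_conic A (pt x y z) \<longleftrightarrow> y * y = x * z" by auto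
  qed
  moreover have "pt 1 0 0 = P" "pt 0 0 1 = R"
    using abs_proj_eq_iff[OF \<open>u \<noteq> 0\<close> rep(1)] abs_proj_eq_iff[OF \<open>w \<noteq> 0\<close> rep(5)] fnz rep
    by (auto simp: pt_def M u_def w_def intro!: exI)
  moreover have "pt 1 1 1 = Q"
    by (simp add: pt_def M v_def rep)
  ultimately show ?thesis by (intro that)
qed

section \<open>The seventh point\<close>

theorem theorem7:
  fixes A :: "('a::real_normed_field)^3^3"
    and p1 p2 p3 p4 p5 p6 p7 B3 G3 G4 B6 :: "'a point"
  assumes "conic A" "nondegenerate A"
    and "distinct [p1, p2, p3, p4, p5, p6]"
    and "\<forall>p \<in> {p1, p2, p3, p4, p5, p6}. on_conic A p"
    and "join p1 p2 \<noteq> join p3 p4" "B3 = meet (join p1 p2) (join p3 p4)"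
    and "join p1 p4 \<noteq> join p3 p6" "G3 = meet (join p1 p4) (join p3 p6)"
    and "G3 \<noteq> B3"
    and "join G3 B3 \<noteq> join p2 p5" "G4 = meet (join G3 B3) (join p2 p5)"
    and "join G3 B3 \<noteq> join p4 p5" "B6 = meet (join G3 B3) (join p4 p5)"
    and "G4 \<noteq> p4" "B6 \<noteq> p6"
    and "join G4 p4 \<noteq> join B6 p6" "p7 = meet (join G4 p4) (join B6 p6)"
  shows "on_conic A p7 \<and>
    (\<exists>B p. conic B \<and> poncelet_chain A B p \<and>
      map p [0..<7] = [p1, p2, p3, p4, p5, p6, p7] \<and>
      (\<not> concurrent (join p1 p2) (join p3 p4) (join p5 p6) \<longrightarrow> nondegenerate B))"
proof -
  have ne: "p1 \<noteq> p2" "p1 \<noteq> p3" "p1 \<noteq> p4" "p1 \<noteq> p5" "p1 \<noteq> p6" "p2 \<noteq> p3" "p2 \<noteq> p4" "p2 \<noteq> p5"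
    "p2 \<noteq> p6" "p3 \<noteq> p4" "p3 \<noteq> p5" "p3 \<noteq> p6" "p4 \<noteq> p5" "p4 \<noteq> p6" "p5 \<noteq> p6"
    using assms(3) by auto
  have on: "on_conic A p1" "on_conic A p2" "on_conic A p3" "on_conic A p4" "on_conic A p5"
    "on_conic A p6" using assms(4) by auto
  obtain M N where "conic_frame M N A"
    and fr: "frame.pt M 1 0 0 = p4" "frame.pt M 1 1 1 = p1" "frame.pt M 0 0 1 = p6"
    using ex_conic_frame[OF assms(1,2) on(4,1,6)] ne by metis
  then interpret conic_frame M N A by simp
  obtain b c e where pts: "p2 = pt (b * b) b 1" "p3 = pt (c * c) c 1" "p5 = pt (e * e) e 1"
    using on_conic_param on ne fr by metis
  note pts = pts fr[symmetric]
  have nz: "b \<noteq> 0" "c \<noteq> 0" "e \<noteq> 0" "b \<noteq> 1" "c \<noteq> 1" "e \<noteq> 1" "b \<noteq> c" "b \<noteq> e" "c \<noteq> e"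
    using ne unfolding pts by auto
  define m where "m = (b * e - b + c) / e"
  have em: "e * m = b * e - b + c" using nz by (simp add: m_def)
  \<comment> \<open>The value of the equation of \<open>p5 p6\<close> at \<open>B3\<close>; it
    vanishes when \<open>p1 p2\<close>, \<open>p3 p4\<close>, \<open>p5 p6\<close> are
    concurrent.\<close>
  define \<delta> where "\<delta> = c + b * c - b - e * c"
  have l12: "join p1 p2 = ln 1 (- (1 + b)) b"
    by (rule join_eqI[OF ne(1)]) (simp_all add: pts incident_iff algebra_simps)
  have l34: "join p3 p4 = ln 0 1 (- c)"
    by (rule join_eqI[OF ne(10)]) (simp_all add: pts incident_iff algebra_simps)
  have l14: "join p1 p4 = ln 0 1 (- 1)"
    by (rule join_eqI[OF ne(3)]) (simp_all add: pts incident_iff algebra_simps)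
  have l36: "join p3 p6 = ln 1 (- c) 0"
    by (rule join_eqI[OF ne(12)]) (simp_all add: pts incident_iff algebra_simps)
  have l25: "join p2 p5 = ln 1 (- (b + e)) (b * e)"
    by (rule join_eqI[OF ne(8)]) (simp_all add: pts incident_iff algebra_simps)
  have l45: "join p4 p5 = ln 0 1 (- e)"
    by (rule join_eqI[OF ne(13)]) (simp_all add: pts incident_iff algebra_simps)
  have l56: "join p5 p6 = ln 1 (- e) 0"
    by (rule join_eqI[OF ne(15)]) (simp_all add: pts incident_iff algebra_simps)
  have B3: "B3 = pt ((1 + b) * c - b) c 1"
    unfolding assms(6)
    by (rule meet_eqI[OF assms(5)]) (simp_all add: l12 l34 incident_iff algebra_simps)
  have G3: "G3 = pt c 1 1"
    unfolding assms(8)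
    by (rule meet_eqI[OF assms(7)]) (simp_all add: l14 l36 incident_iff algebra_simps)
  have g: "join G3 B3 = ln 1 (- b) (b - c)"
    by (rule join_eqI[OF assms(9)]) (simp_all add: B3 G3 incident_iff algebra_simps)
  \<comment> \<open>Representatives are scaled to avoid fractions. \<open>G4\<close> satisfies
    \<open>y = m * z\<close> and \<open>B6\<close> satisfies \<open>x = m * y\<close>; these are the
    equations of the lines to \<open>p4\<close> and \<open>p6\<close>, which meet at parameter
    \<open>m\<close>.\<close>
  have G4: "G4 = pt (b * (e * m + c - c) - (b - c) * e) (e * m) e"
    unfolding assms(11) em
    by (rule meet_eqI[OF assms(10)]) (use nz in \<open>simp_all add: g l25 incident_iff algebra_simps\<close>)
  have B6: "B6 = pt (e * m) e 1"
    unfolding assms(13) em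
    by (rule meet_eqI[OF assms(12)]) (simp_all add: g l45 incident_iff algebra_simps)
  have G4p4: "join G4 p4 = ln 0 1 (- m)"
    by (rule join_eqI[OF assms(14)]) (use nz in \<open>simp_all add: pts G4 incident_iff\<close>)
  have B6p6: "join B6 p6 = ln 1 (- m) 0"
    by (rule join_eqI[OF assms(15)]) (simp_all add: pts B6 incident_iff)
  have p7: "p7 = pt (m * m) m 1"
    unfolding assms(17)
    by (rule meet_eqI[OF assms(16)]) (simp_all add: G4p4 B6p6 incident_iff)
  have on7: "on_conic A p7" by (simp add: p7 on_conic_iff)

  \<comment> \<open>On the lines \<open>ln 0 1 (- k)\<close> through \<open>p4\<close> half the form
    of \<open>D\<close> is \<open>b * (k - c) * (k - e)\<close>, and on the lines
    \<open>ln 1 (- k) 0\<close> through \<open>p6\<close> it is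
    \<open>b * c * e * (k - e) * (k - m)\<close>. This leaves only the coefficient \<open>d\<close>
    of \<open>x * z\<close>, which tangency of \<open>p1 p2\<close> determines; by
    \<open>em\<close>, the line \<open>p2 p3\<close> is then tangent too. Doubling the form avoids
    halves in the matrix.\<close>
  define d where "d = (c + e) * b * b + c * (e * e + e * m) - (b - c) * (b - e) * (1 + c)
    - 2 * b * c * e"
  define D :: "'a^3^3" where "D = vector
    [vector [2 * b * c * e * (e * m), b * c * e * (e + m), d],
     vector [b * c * e * (e + m), 2 * b * c * e, b * (c + e)],
     vector [d, b * (c + e), 2 * b]]"
  define B where "B = M ** D ** transpose M"
  have D: "scalar_product (vector [x, y, z]) (D *v vector [x, y, z]) =
    2 * (b * c * e * (e * m) * x * x + b * c * e * (e + m) * x * y + d * x * z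
      + b * c * e * y * y + b * (c + e) * y * z + b * z * z)" for x y z
    by (simp add: D_def scalar_product_def matrix_vector_mult_def sum_3 algebra_simps)
  have D_sym: "transpose D = D"
    by (simp add: D_def vec_eq_iff forall_3 transpose_def)
  \<comment> \<open>All factors except \<open>\<delta>\<close> are nonzero by \<open>nz\<close>, so
    the inner conic can degenerate only in the concurrent case.\<close>
  have detD: "det D = 2 * b * c * (e - 1) * (b - c) * (b - e) * (c - e)^2 * \<delta>"
  proof -
    \<comment> \<open>Regrouping makes \<open>m\<close> occur only in the product
      \<open>e * m\<close>, so that \<open>em\<close> yields a polynomial identity in
      \<open>b\<close>, \<open>c\<close>, \<open>e\<close>.\<close>
    have k: "b * c * e * (e + m) = b * c * (e * e + e * m)" by (simp add: algebra_simps)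
    show ?thesis
      unfolding det_3 D_def \<delta>_def d_def vector_3 k em
      by (simp add: power2_eq_square algebra_simps)
  qed
  have detM: "det M \<noteq> 0"
    using MN det_mul[of M N] by auto
  have detB: "det B = det M * det D * det M"
    by (simp add: B_def det_mul)
  have B_sym: "transpose B = B"
    by (simp add: B_def matrix_transpose_mul D_sym matrix_mul_assoc)
  have tan: "tangent B (ln x y z) \<longleftrightarrow> b * c * e * (e * m) * x * x + b * c * e * (e + m) * x * y
      + d * x * z + b * c * e * y * y + b * (c + e) * y * z + b * z * z = 0"
    if "x \<noteq> 0 \<or> y \<noteq> 0 \<or> z \<noteq> 0" for x y z
    by (simp only: B_def tangent_iff[OF that] D mult_eq_0_iff numeral_neq_zero simp_thms)
  \<comment> \<open>Only the term \<open>b * z * z\<close> survives here, so \<open>B\<close> is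
    nonzero even when \<open>\<delta> = 0\<close>.\<close>
  have "\<not> tangent B (ln 0 0 1)" using nz by (simp add: tan)
  then have B0: "B \<noteq> 0"
    using tangent_0 by blast
  have nondeg: "nondegenerate B" if "\<not> concurrent (join p1 p2) (join p3 p4) (join p5 p6)"
  proof -
    have "\<delta> \<noteq> 0"
    proof
      assume "\<delta> = 0"
      then have "incident (pt ((1 + b) * c - b) c 1) (join p5 p6)"
        by (simp add: l56 incident_iff \<delta>_def algebra_simps)
      moreover have "incident (pt ((1 + b) * c - b) c 1) (join p1 p2)"
        "incident (pt ((1 + b) * c - b) c 1) (join p3 p4)"
        by (simp_all add: l12 l34 incident_iff algebra_simps)
      ultimately show False using that unfolding concurrent_def by blast
    qed
    with nz show ?thesis by (simp add: nondegenerate_def detB detD detM)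
  qed

  \<comment> \<open>Six steps need seven lines. The last one, the other tangent through
    \<open>p7\<close>, is merely chosen.\<close>
  define l :: "nat \<Rightarrow> 'a line" where
    "l i = [ln 1 (- (1 + b)) b, ln 1 (- (b + c)) (b * c), ln 0 1 (- c), ln 0 1 (- e),
      ln 1 (- e) 0, ln 1 (- m) 0, SOME n. other_tangent B p7 (ln 1 (- m) 0) n] ! i" for i
  define p :: "nat \<Rightarrow> 'a point" where "p i = [p1, p2, p3, p4, p5, p6, p7] ! i" for i
  have tans12: "tangent B (ln 1 (- (1 + b)) b)" "tangent B (ln 1 (- (b + c)) (b * c))"
    by (rule iffD2[OF tan], simp, use em d_def in algebra)+
  have tans36: "tangent B (ln 0 1 (- c))" "tangent B (ln 0 1 (- e))" "tangent B (ln 1 (- e) 0)"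
    "tangent B (ln 1 (- m) 0)"
    by (simp_all add: tan algebra_simps)
  note tans = tans12 tans36
  have inc: "incident p1 (ln 1 (- (1 + b)) b)" "incident p2 (ln 1 (- (1 + b)) b)"
    "incident p2 (ln 1 (- (b + c)) (b * c))" "incident p3 (ln 1 (- (b + c)) (b * c))"
    "incident p3 (ln 0 1 (- c))" "incident p4 (ln 0 1 (- c))"
    "incident p4 (ln 0 1 (- e))" "incident p5 (ln 0 1 (- e))"
    "incident p5 (ln 1 (- e) 0)" "incident p6 (ln 1 (- e) 0)"
    "incident p6 (ln 1 (- m) 0)" "incident p7 (ln 1 (- m) 0)"
    by (simp_all add: pts p7 incident_iff algebra_simps)
  \<comment> \<open>Each of these four lines misses a point of its predecessor, so the first five
    lines change at every step.\<close>
  have ninc: "\<not> incident p1 (ln 1 (- (b + c)) (b * c))" "\<not> incident p2 (ln 0 1 (- c))"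
    "\<not> incident p3 (ln 0 1 (- e))" "\<not> incident p4 (ln 1 (- e) 0)"
  proof -
    have "1 + (- b - c) + b * c = (b - 1) * (c - 1)" by (simp add: algebra_simps)
    then show "\<not> incident p1 (ln 1 (- (b + c)) (b * c))"
      using nz by (simp add: pts incident_iff)
  qed (use nz in \<open>simp_all add: pts incident_iff\<close>)
  have int6: "other_intersection A (ln 1 (- m) 0) p6 p7"
    unfolding other_intersection_def
  proof (intro conjI on7 inc impI allI)
    \<comment> \<open>The closing point may coincide with \<open>p6\<close>. Then
      \<open>m = 0\<close>, and the line is \<open>x = 0\<close>, which touches the outer conic at
      \<open>p6\<close>.\<close>
    fix R assume "p7 = p6" and R: "on_conic A R \<and> incident R (ln 1 (- m) 0)"
    have "m = 0"
    proof -
      have "incident p7 (ln 0 1 (- m))" by (simp add: p7 incident_iff)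
      with \<open>p7 = p6\<close> show ?thesis by (simp add: pts incident_iff)
    qed
    have "R \<noteq> p4" using R by (auto simp: pts incident_iff)
    then obtain t where t: "R = pt (t * t) t 1" using R on_conic_param pts by metis
    with R \<open>m = 0\<close> have "t = 0" by (simp add: incident_iff)
    with t show "R = p6" by (simp add: pts)
  qed
  have tan6: "other_tangent B p6 (ln 1 (- e) 0) (ln 1 (- m) 0)"
    unfolding other_tangent_def
  proof (intro conjI tans inc impI allI)
    \<comment> \<open>If \<open>p6 p7\<close> falls back onto \<open>p5 p6\<close>, then
      \<open>m = e\<close>, and on the lines through \<open>p6\<close> the dual form is a multiple
      of a square, so there is only one tangent.\<close>
    fix n assume "ln 1 (- m) 0 = ln 1 (- e) 0" and n: "tangent B n \<and> incident p6 n"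
    then have "incident p5 (ln 1 (- m) 0)" using inc by simp
    then have "m = e" using nz by (simp add: pts incident_iff)
    obtain x y z where xyz: "n = ln x y z" "x \<noteq> 0 \<or> y \<noteq> 0 \<or> z \<noteq> 0" by (rule ln_surj)
    with n have "z = 0" by (simp add: pts incident_iff)
    with n xyz have "b * c * e * ((y + e * x) * (y + e * x)) = 0"
      by (simp add: tan \<open>m = e\<close> algebra_simps)
    with nz have "y = - e * x" by (simp add: eq_neg_iff_add_eq_0)
    then have "incident p5 n" using xyz \<open>z = 0\<close> by (simp add: pts incident_iff)
    with n inc ex1_line[OF ne(15)] show "n = ln 1 (- e) 0" by blast
  qed
  have tan7: "other_tangent B p7 (ln 1 (- m) 0) (SOME n. other_tangent B p7 (ln 1 (- m) 0) n)"
    using ex_other_tangent[OF tans(6) inc(12)] by (rule someI_ex)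
  have steps: "other_intersection A (l i) (p i) (p (Suc i)) \<and>
    other_tangent B (p (Suc i)) (l i) (l (Suc i))" if "i < 6" for i
  proof -
    have "i \<in> {0, 1, 2, 3, 4, 5}" using that by auto
    then show ?thesis
    proof (elim insertE emptyE)
      assume i: "i = 5"
      show ?thesis using int6 tan7 by (simp add: i p_def l_def)
    next
      assume i: "i = 4"
      show ?thesis using tan6 on inc ne by (simp add: i p_def l_def other_intersection_def)
    qed (use on inc ninc ne tans in
        \<open>auto simp: p_def l_def other_intersection_def other_tangent_def eval_nat_numeral\<close>)
  qed
  obtain q where q: "poncelet_chain A B q" "\<forall>i\<le>6. q i = p i"
    using poncelet_chain_extend[of A p l B 6] steps on(1) inc(1) tans(1)
    by (auto simp: p_def l_def)
  have "map q [0..<7] = map p [0..<7]" using q(2) by auto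
  also have "\<dots> = [p1, p2, p3, p4, p5, p6, p7]"
    by (rule nth_equalityI) (simp_all add: p_def)
  finally have "map q [0..<7] = [p1, p2, p3, p4, p5, p6, p7]" .
  moreover have "conic B" using B_sym B0 by (simp add: conic_def)
  ultimately show ?thesis
    using on7 q(1) nondeg by (intro conjI exI[of _ B] exI[of _ q]) auto
qed

end
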